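(* Let $X,Y$ be complex Banach spaces. Suppose $J\subset\mathcal{K}(X,Y)\subset\mathcal{L}(X,Y)$ is an $M$-ideal in $\mathcal{L}(X,Y)$ and $J$ contains all finite rank operators. Assume further that $0$ is not a weak$^*$-accumulation point of $\partial_e X^{**}_1$ and $0$ is not a weak$^*$-accumulation point of $\partial_e Y^*_1$. Let $A\in\mathcal{L}(X,Y)$ with $\|A\|=1$ and suppose $$\partial_A=\overline{CO}\{x^{**}\otimes y^*: x^{**}(A^*(y^* ))=1,\ x^{**}\in\partial_e X^{**}_1,\ y^*\in\partial_e Y^*_1\},$$ with closure in the weak$^*$-topology of $\mathcal{L}(X,Y)^*$. Then $d(A,J)<1$.
   Context: $\mathcal{L}(X,Y)$ is the space of bounded operators from $X$ to $Y$ with the operator norm and $\mathcal{K}(X,Y)$ its subspace of compact operators. $\partial_A=\{\Lambda\in\mathcal{L}(X,Y)^*:\|\Lambda\|=1,\ \Lambda(A)=\|A\|\}$. $E_1$ is the closed unit ball of a Banach space $E$, $\partial_e C$ is the set of extreme points of a convex set $C$, $CO$ denotes convex hull, the bar denotes closure, and $d(\cdot,\cdot)$ is norm distance. The weak$^*$-topology on $X^{**}$ is that of the dual of $X^*$, and on $Y^*$ that of the dual of $Y$. For $x^{**}\in X^{**}$, $y^*\in Y^*$, $x^{**}\otimes y^*$ is the functional on $\mathcal{L}(X,Y)$ given by $(x^{**}\otimes y^* )(T)=x^{**}(T^*(y^* ))$. A closed subspace $J$ of a Banach space $E$ is an $M$-ideal if there is a linear projection $P:E^*\to E^*$ with $\ker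 P=J^\perp$ (annihilator) and $\|e^*\|=\|P(e^* )\|+\|e^*-P(e^* )\|$ for all $e^*\in E^*$. *)

theory Defs
  imports "HOL-Analysis.Analysis"
begin

section \<open>Complex normed spaces and complex Banach spaces\<close>

class scaleC =
  fixes scaleC :: "complex \<Rightarrow> 'a \<Rightarrow> 'a"  (infixr "*\<^sub>C" 75)

text \<open>The real structure is part of the class (so that the real library applies) and is
  required to be the restriction of the complex one.\<close>

class complex_normed_vector = real_normed_vector + scaleC +
  assumes scaleC_add_right: "a *\<^sub>C (x + y) = a *\<^sub>C x + a *\<^sub>C y"
    and scaleC_add_left: "(a + b) *\<^sub>C x = a *\<^sub>C x + b *\<^sub>C x"
    and scaleC_scaleC: "a *\<^sub>C b *\<^sub>C x = (a * b) *\<^sub>C x"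
    and scaleR_scaleC: "r *\<^sub>R x = complex_of_real r *\<^sub>C x"
    and norm_scaleC: "norm (a *\<^sub>C x) = cmod a * norm x"

class cbanach = complex_normed_vector + banach

instantiation complex :: cbanach
begin
definition scaleC_complex :: "complex \<Rightarrow> complex \<Rightarrow> complex"
  where "scaleC_complex a x = a * x"
instance
  by intro_classes
    (auto simp: scaleC_complex_def algebra_simps norm_mult scaleR_conv_of_real)
end

lemma scaleC_one: "1 *\<^sub>C x = (x :: 'a::complex_normed_vector)"
  by (metis of_real_1 scaleR_one scaleR_scaleC)

global_interpretation cvec: vector_space "scaleC :: complex \<Rightarrow> 'a \<Rightarrow> 'a::complex_normed_vector"
  defines csubspace = cvec.subspace
    and cspan = cvec.span
  by unfold_locales
    (simp_all add: scaleC_add_right scaleC_add_left scaleC_scaleC scaleC_one)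

abbreviation clinear :: "('a::complex_normed_vector \<Rightarrow> 'b::complex_normed_vector) \<Rightarrow> bool"
  where "clinear \<equiv> Vector_Spaces.linear scaleC scaleC"

lemma scaleC_scaleR_commute: "a *\<^sub>C (r *\<^sub>R x) = r *\<^sub>R (a *\<^sub>C (x :: 'a::complex_normed_vector))"
  by (simp add: scaleR_scaleC mult.commute)

lemma bounded_linear_scaleC_right:
  "bounded_linear (\<lambda>x :: 'a::complex_normed_vector. a *\<^sub>C x)"
  by (rule bounded_linear_intro[where K = "cmod a"])
    (simp_all add: scaleC_add_right scaleC_scaleR_commute norm_scaleC)


section \<open>Bounded complex-linear operators\<close>

typedef (overloaded) ('a, 'b) cblinfun  ("(_ \<Rightarrow>\<^sub>C\<^sub>L /_)" [22, 21] 21) =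
  "{T :: 'a::complex_normed_vector \<Rightarrow>\<^sub>L 'b::complex_normed_vector.
      \<forall>c x. blinfun_apply T (c *\<^sub>C x) = c *\<^sub>C blinfun_apply T x}"
  morphisms blinfun_of_cblinfun cblinfun_of_blinfun
  by (rule exI[of _ 0]) simp

setup_lifting type_definition_cblinfun

lift_definition cblinfun_apply ::
    "'a::complex_normed_vector \<Rightarrow>\<^sub>C\<^sub>L 'b::complex_normed_vector \<Rightarrow> 'a \<Rightarrow> 'b"
  is blinfun_apply .

declare [[coercion cblinfun_apply]]

lemma cblinfun_eqI: "(\<And>x. cblinfun_apply S x = cblinfun_apply T x) \<Longrightarrow> S = T"
  by transfer (rule blinfun_eqI)

lemma cblinfun_scaleC_right: "cblinfun_apply T (c *\<^sub>C x) = c *\<^sub>C cblinfun_apply T x"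
  by transfer simp

lemma bounded_linear_cblinfun_apply: "bounded_linear (cblinfun_apply T)"
  by transfer (rule blinfun.bounded_linear_right)

instantiation cblinfun :: (complex_normed_vector, complex_normed_vector) complex_normed_vector
begin

lift_definition zero_cblinfun :: "'a \<Rightarrow>\<^sub>C\<^sub>L 'b" is 0 by simp
lift_definition plus_cblinfun :: "'a \<Rightarrow>\<^sub>C\<^sub>L 'b \<Rightarrow> 'a \<Rightarrow>\<^sub>C\<^sub>L 'b \<Rightarrow> 'a \<Rightarrow>\<^sub>C\<^sub>L 'b" is "(+)"
  by (simp add: blinfun.add_left scaleC_add_right)
lift_definition uminus_cblinfun :: "'a \<Rightarrow>\<^sub>C\<^sub>L 'b \<Rightarrow> 'a \<Rightarrow>\<^sub>C\<^sub>L 'b" is uminus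
  by (simp add: blinfun.minus_left)
lift_definition minus_cblinfun :: "'a \<Rightarrow>\<^sub>C\<^sub>L 'b \<Rightarrow> 'a \<Rightarrow>\<^sub>C\<^sub>L 'b \<Rightarrow> 'a \<Rightarrow>\<^sub>C\<^sub>L 'b" is "(-)"
  by (simp add: blinfun.diff_left cvec.scale_right_diff_distrib)
lift_definition scaleR_cblinfun :: "real \<Rightarrow> 'a \<Rightarrow>\<^sub>C\<^sub>L 'b \<Rightarrow> 'a \<Rightarrow>\<^sub>C\<^sub>L 'b" is scaleR
  by (simp add: blinfun.scaleR_left scaleC_scaleR_commute)
lift_definition scaleC_cblinfun :: "complex \<Rightarrow> 'a \<Rightarrow>\<^sub>C\<^sub>L 'b \<Rightarrow> 'a \<Rightarrow>\<^sub>C\<^sub>L 'b"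
  is "\<lambda>c T. Blinfun (\<lambda>x. c *\<^sub>C blinfun_apply T x)"
  by (simp add: bounded_linear_Blinfun_apply mult.commute
      bounded_linear_compose[OF bounded_linear_scaleC_right blinfun.bounded_linear_right])
lift_definition norm_cblinfun :: "'a \<Rightarrow>\<^sub>C\<^sub>L 'b \<Rightarrow> real" is norm .

definition "dist_cblinfun (S :: 'a \<Rightarrow>\<^sub>C\<^sub>L 'b) T = norm (S - T)"
definition "sgn_cblinfun (T :: 'a \<Rightarrow>\<^sub>C\<^sub>L 'b) = inverse (norm T) *\<^sub>R T"
definition [code del]: "(uniformity :: (('a \<Rightarrow>\<^sub>C\<^sub>L 'b) \<times> ('a \<Rightarrow>\<^sub>C\<^sub>L 'b)) filter) =
  (INF e\<in>{0 <..}. principal {(S, T). dist S T < e})"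
definition open_cblinfun :: "('a \<Rightarrow>\<^sub>C\<^sub>L 'b) set \<Rightarrow> bool" where [code del]:
  "open_cblinfun U = (\<forall>S\<in>U. \<forall>\<^sub>F (S', T) in uniformity. S' = S \<longrightarrow> T \<in> U)"

lemma blinfun_apply_scaleC:
  fixes T :: "'a \<Rightarrow>\<^sub>L 'b"
  shows "blinfun_apply (Blinfun (\<lambda>x. c *\<^sub>C blinfun_apply T x)) x
     = c *\<^sub>C blinfun_apply T x"
  by (simp add: bounded_linear_Blinfun_apply
      bounded_linear_compose[OF bounded_linear_scaleC_right blinfun.bounded_linear_right])

lemma cblinfun_add_left: "cblinfun_apply (S + T) x = cblinfun_apply S x + cblinfun_apply T x"
  by transfer (rule blinfun.add_left)

lemma cblinfun_scaleR_left: "cblinfun_apply (r *\<^sub>R T) x = r *\<^sub>R cblinfun_apply T x"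
  by transfer (rule blinfun.scaleR_left)

lemma cblinfun_scaleC_left: "cblinfun_apply (c *\<^sub>C T) x = c *\<^sub>C cblinfun_apply T x"
  by transfer (rule blinfun_apply_scaleC)

instance
proof
  fix S T U :: "'a \<Rightarrow>\<^sub>C\<^sub>L 'b" and r s :: real and a b :: complex
  show "S + T + U = S + (T + U)" by transfer simp
  show "S + T = T + S" by transfer simp
  show "0 + S = S" by transfer simp
  show "- S + S = 0" by transfer simp
  show "S - T = S + - T" by transfer simp
  show "r *\<^sub>R (S + T) = r *\<^sub>R S + r *\<^sub>R T" by transfer (simp add: scaleR_add_right)
  show "(r + s) *\<^sub>R S = r *\<^sub>R S + s *\<^sub>R S" by transfer (simp add: scaleR_add_left)
  show "r *\<^sub>R s *\<^sub>R S = (r * s) *\<^sub>R S" by transfer simp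
  show "1 *\<^sub>R S = S" by transfer simp
  show "dist S T = norm (S - T)" by (simp add: dist_cblinfun_def)
  show "sgn S = inverse (norm S) *\<^sub>R S" by (simp add: sgn_cblinfun_def)
  show "(uniformity :: (('a \<Rightarrow>\<^sub>C\<^sub>L 'b) \<times> ('a \<Rightarrow>\<^sub>C\<^sub>L 'b)) filter) =
      (INF e\<in>{0 <..}. principal {(S, T). dist S T < e})"
    by (simp add: uniformity_cblinfun_def)
  show "open V = (\<forall>S\<in>V. \<forall>\<^sub>F (S', T) in uniformity. S' = S \<longrightarrow> T \<in> V)"
    for V :: "('a \<Rightarrow>\<^sub>C\<^sub>L 'b) set"
    by (simp add: open_cblinfun_def)
  show "norm S = 0 \<longleftrightarrow> S = 0" by transfer simp
  show "norm (S + T) \<le> norm S + norm T" by transfer (rule norm_triangle_ineq)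
  show "norm (r *\<^sub>R S) = \<bar>r\<bar> * norm S" by transfer simp
  note pointwise = cblinfun_add_left cblinfun_scaleR_left cblinfun_scaleC_left
  show "a *\<^sub>C (S + T) = a *\<^sub>C S + a *\<^sub>C T"
    by (rule cblinfun_eqI) (simp only: pointwise scaleC_add_right)
  show "(a + b) *\<^sub>C S = a *\<^sub>C S + b *\<^sub>C S"
    by (rule cblinfun_eqI) (simp only: pointwise scaleC_add_left)
  show "a *\<^sub>C b *\<^sub>C S = (a * b) *\<^sub>C S"
    by (rule cblinfun_eqI) (simp only: pointwise scaleC_scaleC)
  show "r *\<^sub>R S = complex_of_real r *\<^sub>C S"
    by (rule cblinfun_eqI) (simp only: pointwise scaleR_scaleC)
  show "norm (a *\<^sub>C S) = cmod a * norm S"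
  proof transfer
    fix a :: complex and T :: "'a \<Rightarrow>\<^sub>L 'b"
    let ?S = "Blinfun (\<lambda>x. a *\<^sub>C blinfun_apply T x)"
    have le: "norm (Blinfun (\<lambda>x. a *\<^sub>C blinfun_apply T x)) \<le> cmod a * norm T"
      for a :: complex and T :: "'a \<Rightarrow>\<^sub>L 'b"
      by (rule norm_blinfun_bound)
        (simp_all add: blinfun_apply_scaleC norm_scaleC mult.assoc mult_left_mono norm_blinfun)
    show "norm ?S = cmod a * norm T"
    proof (cases "a = 0")
      case True
      then show ?thesis using le[of a T] by simp
    next
      case False
      have "T = Blinfun (\<lambda>x. inverse a *\<^sub>C blinfun_apply ?S x)"
        by (rule blinfun_eqI) (simp add: blinfun_apply_scaleC blinfun_apply_inverse False)
      then have "norm T \<le> cmod (inverse a) * norm ?S"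
        using le[of "inverse a" ?S] by simp
      then have "cmod a * norm T \<le> norm ?S"
        using False by (simp add: norm_divide field_simps)
      with le[of a T] show ?thesis by simp
    qed
  qed
qed

end

lemma norm_cblinfun: "norm (cblinfun_apply T x) \<le> norm T * norm x"
  by transfer (rule norm_blinfun)

lemma norm_cblinfun_bound:
  "0 \<le> b \<Longrightarrow> (\<And>x. norm (cblinfun_apply T x) \<le> b * norm x) \<Longrightarrow> norm T \<le> b"
  by transfer (rule norm_blinfun_bound)

instance cblinfun :: (complex_normed_vector, cbanach) cbanach
proof
  fix X :: "nat \<Rightarrow> 'a \<Rightarrow>\<^sub>C\<^sub>L 'b"
  assume X: "Cauchy X"
  have dist_eq: "dist (blinfun_of_cblinfun S) (blinfun_of_cblinfun T) = dist S T"
    for S T :: "'a \<Rightarrow>\<^sub>C\<^sub>L 'b"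
    unfolding dist_norm by transfer simp
  have "Cauchy (\<lambda>n. blinfun_of_cblinfun (X n))"
    using X by (simp add: Cauchy_def dist_eq)
  then have "convergent (\<lambda>n. blinfun_of_cblinfun (X n))"
    by (rule Cauchy_convergent)
  then obtain L where L: "(\<lambda>n. blinfun_of_cblinfun (X n)) \<longlonglongrightarrow> L"
    by (auto simp: convergent_def)
  have lim: "(\<lambda>n. blinfun_apply (blinfun_of_cblinfun (X n)) x) \<longlonglongrightarrow> blinfun_apply L x" for x
    using L by (intro tendsto_intros)
  have "blinfun_apply L (c *\<^sub>C x) = c *\<^sub>C blinfun_apply L x" for c x
  proof (rule LIMSEQ_unique[OF lim])
    have "(\<lambda>n. c *\<^sub>C blinfun_apply (blinfun_of_cblinfun (X n)) x) \<longlonglongrightarrow> c *\<^sub>C blinfun_apply L x"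
      by (rule bounded_linear.tendsto[OF bounded_linear_scaleC_right lim])
    moreover have "blinfun_apply (blinfun_of_cblinfun T) (c *\<^sub>C x)
        = c *\<^sub>C blinfun_apply (blinfun_of_cblinfun T) x" for T :: "'a \<Rightarrow>\<^sub>C\<^sub>L 'b"
      using blinfun_of_cblinfun[of T] by blast
    ultimately show "(\<lambda>n. blinfun_apply (blinfun_of_cblinfun (X n)) (c *\<^sub>C x))
        \<longlonglongrightarrow> c *\<^sub>C blinfun_apply L x"
      by (simp only:)
  qed
  then have "blinfun_of_cblinfun (cblinfun_of_blinfun L) = L"
    by (intro cblinfun_of_blinfun_inverse) simp
  then have "dist (X n) (cblinfun_of_blinfun L) = dist (blinfun_of_cblinfun (X n)) L" for n
    using dist_eq[of "X n" "cblinfun_of_blinfun L"] by simp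
  then have "X \<longlonglongrightarrow> cblinfun_of_blinfun L"
    using L by (simp only: tendsto_iff)
  then show "convergent X" by (auto simp: convergent_def)
qed

lift_definition cblinfun_compose ::
    "'b::complex_normed_vector \<Rightarrow>\<^sub>C\<^sub>L 'c::complex_normed_vector \<Rightarrow>
     'a::complex_normed_vector \<Rightarrow>\<^sub>C\<^sub>L 'b \<Rightarrow> 'a \<Rightarrow>\<^sub>C\<^sub>L 'c"  (infixl "o\<^sub>C" 67)
  is blinfun_compose
  by simp

lemma cblinfun_apply_compose:
  "cblinfun_apply (S o\<^sub>C T) x = cblinfun_apply S (cblinfun_apply T x)"
  by transfer simp

lemma norm_cblinfun_compose: "norm (S o\<^sub>C T) \<le> norm S * norm T"
  by transfer (rule norm_blinfun_compose)

text \<open>Meaningful only for bounded complex-linear functions; each use below is followed by the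
  lemma that evaluates it.\<close>

definition cblinfun_of_fun ::
    "('a::complex_normed_vector \<Rightarrow> 'b::complex_normed_vector) \<Rightarrow> 'a \<Rightarrow>\<^sub>C\<^sub>L 'b"
  where "cblinfun_of_fun f = cblinfun_of_blinfun (Blinfun f)"

lemma cblinfun_apply_of_fun:
  assumes add: "\<And>x y. f (x + y) = f x + f y"
    and scale: "\<And>c x. f (c *\<^sub>C x) = c *\<^sub>C f x"
    and bound: "\<And>x. norm (f x) \<le> norm x * K"
  shows "cblinfun_apply (cblinfun_of_fun f) = f"
proof -
  have "bounded_linear f"
    by (rule bounded_linear_intro[OF add _ bound]) (simp add: scaleR_scaleC scale)
  then show ?thesis
    by (simp add: cblinfun_of_fun_def cblinfun_apply.rep_eq cblinfun_of_blinfun_inverse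
        bounded_linear_Blinfun_apply scale)
qed


section \<open>Duals, adjoints and weak* topologies\<close>

type_synonym 'a cdual = "('a, complex) cblinfun"

definition cadjoint ::
    "'a::complex_normed_vector \<Rightarrow>\<^sub>C\<^sub>L 'b::complex_normed_vector \<Rightarrow> 'b cdual \<Rightarrow>\<^sub>C\<^sub>L 'a cdual"
  where "cadjoint T = cblinfun_of_fun (\<lambda>g. g o\<^sub>C T)"

lemma cblinfun_apply_cadjoint: "cblinfun_apply (cadjoint T) g = g o\<^sub>C T"
proof -
  have "cblinfun_apply (cadjoint T) = (\<lambda>g. g o\<^sub>C T)"
    unfolding cadjoint_def
    by (rule cblinfun_apply_of_fun[where K = "norm T"])
      (auto intro!: cblinfun_eqI norm_cblinfun_compose
        simp: cblinfun_apply_compose cblinfun_add_left cblinfun_scaleC_left)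
  then show ?thesis by simp
qed

definition tensor_functional ::
    "'a::complex_normed_vector cdual cdual \<Rightarrow> 'b::complex_normed_vector cdual \<Rightarrow>
     ('a \<Rightarrow>\<^sub>C\<^sub>L 'b) cdual"  (infixr "\<otimes>\<^sub>C" 70)
  where "F \<otimes>\<^sub>C g = cblinfun_of_fun (\<lambda>T. F (cadjoint T g))"

lemma cblinfun_apply_tensor_functional:
  "cblinfun_apply (F \<otimes>\<^sub>C g) T = cblinfun_apply F (cblinfun_apply (cadjoint T) g)"
proof -
  have add: "g o\<^sub>C (S + T) = g o\<^sub>C S + g o\<^sub>C T" for S T :: "'a \<Rightarrow>\<^sub>C\<^sub>L 'b"
    by (rule cblinfun_eqI)
      (simp add: cblinfun_apply_compose cblinfun_add_left
        linear_add[OF bounded_linear.linear[OF bounded_linear_cblinfun_apply]])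
  have scale: "g o\<^sub>C (c *\<^sub>C T) = c *\<^sub>C (g o\<^sub>C T)" for c and T :: "'a \<Rightarrow>\<^sub>C\<^sub>L 'b"
    by (rule cblinfun_eqI)
      (simp add: cblinfun_apply_compose cblinfun_scaleC_left cblinfun_scaleC_right)
  have "cmod (F (cadjoint T g)) \<le> norm T * (norm F * norm g)" for T :: "'a \<Rightarrow>\<^sub>C\<^sub>L 'b"
  proof -
    have "cmod (F (cadjoint T g)) \<le> norm F * norm (g o\<^sub>C T)"
      unfolding cblinfun_apply_cadjoint by (rule norm_cblinfun)
    also have "\<dots> \<le> norm F * (norm g * norm T)"
      by (intro mult_left_mono norm_cblinfun_compose norm_ge_zero)
    finally show ?thesis by (simp add: mult_ac)
  qed
  then have "cblinfun_apply (F \<otimes>\<^sub>C g) = (\<lambda>T. F (cadjoint T g))"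
    unfolding tensor_functional_def
    by (intro cblinfun_apply_of_fun)
      (simp_all add: cblinfun_apply_cadjoint add scale cblinfun_scaleC_right
        linear_add[OF bounded_linear.linear[OF bounded_linear_cblinfun_apply]])
  then show ?thesis by simp
qed

text \<open>Pointwise convergence: \<^term>\<open>euclidean\<close> on a function type is the product topology.\<close>

definition weak_star_topology :: "'a::complex_normed_vector cdual topology"
  where "weak_star_topology = pullback_topology UNIV cblinfun_apply euclidean"


section \<open>Compact and finite rank operators, M-ideals\<close>

definition compact_operators :: "('a::complex_normed_vector \<Rightarrow>\<^sub>C\<^sub>L 'b::complex_normed_vector) set"
  where "compact_operators = {T. compact (closure (cblinfun_apply T ` cball 0 1))}"

definition finite_rank_operators ::
    "('a::complex_normed_vector \<Rightarrow>\<^sub>C\<^sub>L 'b::complex_normed_vector) set"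
  where "finite_rank_operators = {T. \<exists>B. finite B \<and> range (cblinfun_apply T) \<subseteq> cspan B}"

definition annihilator :: "'a::complex_normed_vector set \<Rightarrow> 'a cdual set"
  where "annihilator J = {f. \<forall>x\<in>J. cblinfun_apply f x = 0}"

definition M_ideal :: "'a::cbanach set \<Rightarrow> bool"
  where "M_ideal J \<longleftrightarrow> closed J \<and> csubspace J \<and>
    (\<exists>P :: 'a cdual \<Rightarrow> 'a cdual. clinear P \<and> P \<circ> P = P \<and>
       {f. P f = 0} = annihilator J \<and> (\<forall>f. norm f = norm (P f) + norm (f - P f)))"

definition norming_functionals ::
    "'a::complex_normed_vector \<Rightarrow>\<^sub>C\<^sub>L 'b::complex_normed_vector \<Rightarrow> ('a \<Rightarrow>\<^sub>C\<^sub>L 'b) cdual set"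
  where "norming_functionals A =
    {\<Lambda>. norm \<Lambda> = 1 \<and> cblinfun_apply \<Lambda> A = complex_of_real (norm A)}"

definition extreme_ball :: "'a::complex_normed_vector set"
  where "extreme_ball = {x. x extreme_point_of cball 0 1}"

end

(*
  If d(A,J) = 1, Hahn-Banach gives a functional Lambda in the unit ball that annihilates J and
  norms A, so Lambda is a weak* limit of convex combinations of tensors F \<otimes> g.  Since 0 is not
  an accumulation point of the extreme points, finitely many rank one operators R in J satisfy
  d <= Re ((F \<otimes> g) R) for one of them, with d > 0 independent of F and g.  Grouping by R and
  passing to the limit writes Lambda as a sum of functionals M_R whose norms sum to at most 1 and
  which satisfy d Re (M_R A) <= Re (M_R R).  The annihilator of an M-ideal meets the dual ball in a
  face, so every M_R annihilates J; then Re (M_R A) <= 0 for all R, contradicting Lambda A = 1.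
*)

theory Submission
  imports Defs
begin

section \<open>Hahn--Banach\<close>

definition sublinear :: "('a::real_vector \<Rightarrow> real) \<Rightarrow> bool"
  where "sublinear q \<longleftrightarrow> (\<forall>x y. q (x + y) \<le> q x + q y) \<and> (\<forall>r x. 0 < r \<longrightarrow> q (r *\<^sub>R x) = r * q x)"

text \<open>The upper bound, used with \<open>inverse r\<close> at \<open>r *\<^sub>R x\<close>, is
  the reverse inequality. Infima yield such upper bounds directly.\<close>

lemma sublinearI:
  assumes add: "\<And>x y. q (x + y) \<le> q x + q y"
    and scale: "\<And>r x. 0 < r \<Longrightarrow> q (r *\<^sub>R x) \<le> r * q x"
  shows "sublinear q"
proof -
  have "q (r *\<^sub>R x) = r * q x" if r: "0 < r" for r x
  proof (rule antisym[OF scale[OF r]])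
    have "q x \<le> inverse r * q (r *\<^sub>R x)"
      using scale[of "inverse r" "r *\<^sub>R x"] r by simp
    then show "r * q x \<le> q (r *\<^sub>R x)"
      using r by (simp add: field_simps)
  qed
  then show ?thesis using add by (auto simp: sublinear_def)
qed

lemma sublinear_add: "sublinear q \<Longrightarrow> q (x + y) \<le> q x + q y"
  and sublinear_scaleR: "sublinear q \<Longrightarrow> 0 < r \<Longrightarrow> q (r *\<^sub>R x) = r * q x"
  by (auto simp: sublinear_def)

lemma sublinear_zero: "sublinear q \<Longrightarrow> q 0 = 0"
  using sublinear_scaleR[of q 2 0] by simp

lemma sublinear_minus: "sublinear q \<Longrightarrow> - q (- x) \<le> q x"
  using sublinear_add[of q x "- x"] by (simp add: sublinear_zero)

text \<open>One infimum is taken while the other variable is held fixed. This is how functionals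
  given by infima are shown to be subadditive.\<close>

lemma le_cINF_add:
  fixes f :: "'a \<Rightarrow> real" and g :: "'b \<Rightarrow> real"
  assumes "A \<noteq> {}" "B \<noteq> {}" and le: "\<And>s t. s \<in> A \<Longrightarrow> t \<in> B \<Longrightarrow> c \<le> f s + g t"
  shows "c \<le> (INF s\<in>A. f s) + (INF t\<in>B. g t)"
proof -
  have "c - f s \<le> (INF t\<in>B. g t)" if "s \<in> A" for s
    using assms(2) le[OF that] by (intro cINF_greatest) (auto simp: algebra_simps)
  then have "c - (INF t\<in>B. g t) \<le> f s" if "s \<in> A" for s
    using that by (simp add: algebra_simps)
  then have "c - (INF t\<in>B. g t) \<le> (INF s\<in>A. f s)"
    using assms(1) by (intro cINF_greatest) auto
  then show ?thesis by simp
qed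

text \<open>The infimum over t \<ge> 0 of \<open>p (y + t *\<^sub>R a) - t * p a\<close> works: t =
  0 gives \<open>q \<le> p\<close> and t = 1 the last bound. If p is minimal, then q = p and that
  bound is superadditivity.\<close>

lemma sublinear_tilt:
  assumes p: "sublinear p"
  obtains q where "sublinear q" and "q \<le> p" and "\<And>y. q y \<le> p (y + a) - p a"
proof -
  define f where "f y t = p (y + t *\<^sub>R a) - t * p a" for y t
  define q where "q y = (INF t\<in>{0..}. f y t)" for y
  \<comment> \<open>A lower bound independent of t keeps the infimum finite.\<close>
  have f_ge: "- p (- y) \<le> f y t" if "0 \<le> t" for y t
  proof -
    have "t * p a = p (t *\<^sub>R a)"
      using that sublinear_scaleR[OF p, of t a] sublinear_zero[OF p] by (cases "t = 0") auto
    also have "\<dots> \<le> p (y + t *\<^sub>R a) + p (- y)"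
      using sublinear_add[OF p, of "y + t *\<^sub>R a" "- y"] by simp
    finally show ?thesis by (simp add: f_def)
  qed
  have q_le: "q y \<le> f y t" if "0 \<le> t" for y t
    unfolding q_def using that f_ge by (intro cINF_lower) (auto intro!: bdd_belowI)
  have "sublinear q"
  proof (rule sublinearI)
    fix x y
    have "q (x + y) \<le> f x s + f y t" if "0 \<le> s" "0 \<le> t" for s t
    proof -
      have "q (x + y) \<le> f (x + y) (s + t)"
        using that by (intro q_le) simp
      also have "\<dots> \<le> f x s + f y t"
        using sublinear_add[OF p, of "x + s *\<^sub>R a" "y + t *\<^sub>R a"]
        by (simp add: f_def algebra_simps)
      finally show ?thesis .
    qed
    then show "q (x + y) \<le> q x + q y"
      unfolding q_def[of x] q_def[of y] by (intro le_cINF_add) auto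
  next
    fix r :: real and x assume r: "0 < r"
    have "q (r *\<^sub>R x) / r \<le> f x t" if "0 \<le> t" for t
    proof -
      have "q (r *\<^sub>R x) \<le> f (r *\<^sub>R x) (r * t)"
        using that r by (intro q_le) simp
      also have "\<dots> = r * f x t"
        using sublinear_scaleR[OF p r, of "x + t *\<^sub>R a"]
        by (simp add: f_def algebra_simps)
      finally show ?thesis using r by (simp add: field_simps)
    qed
    then have "q (r *\<^sub>R x) / r \<le> q x"
      unfolding q_def[of x] by (intro cINF_greatest) auto
    then show "q (r *\<^sub>R x) \<le> r * q x" using r by (simp add: field_simps)
  qed
  moreover have "q \<le> p"
    using q_le[of 0] by (auto simp: f_def le_fun_def)
  moreover have "q y \<le> p (y + a) - p a" for y
    using q_le[of 1 y] by (simp add: f_def)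
  ultimately show ?thesis by (rule that)
qed

text \<open>Zorn's lemma on the sublinear functionals below p; a nonempty chain is bounded by its
  pointwise infimum.\<close>

lemma sublinear_minimal:
  assumes p: "sublinear p"
  obtains q where "sublinear q" and "q \<le> p"
    and "\<And>q'. sublinear q' \<Longrightarrow> q' \<le> q \<Longrightarrow> q' = q"
proof -
  define A where "A = {q. sublinear q \<and> q \<le> p}"
  \<comment> \<open>Zorn's lemma yields maximal elements, so the order is reversed.\<close>
  define P where "P = (\<lambda>f g. g \<le> (f :: 'a \<Rightarrow> real))"
  have po: "partial_order_on A (relation_of P A)"
    by (rule partial_order_on_relation_ofI) (auto simp: P_def)
  have "\<exists>u\<in>A. \<forall>q\<in>C. P q u" if C: "C \<in> Chains (relation_of P A)" for C
  proof (cases "C = {}")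
    case True
    then show ?thesis using p by (auto simp: A_def)
  next
    case False
    have C_A: "q \<in> A" if "q \<in> C" for q
      using C that by (auto simp: Chains_def relation_of_def)
    have sub: "sublinear q" if "q \<in> C" for q
      using C_A[OF that] by (simp add: A_def)
    have C_chain: "q \<le> q' \<or> q' \<le> q" if "q \<in> C" "q' \<in> C" for q q'
      using C that by (auto simp: Chains_def relation_of_def P_def)
    define u where "u x = (INF q\<in>C. q x)" for x
    have u_le: "u x \<le> q x" if "q \<in> C" for q x
      unfolding u_def
    proof (intro cINF_lower bdd_belowI2[where m = "- p (- x)"] that)
      fix q assume q: "q \<in> C"
      have "q (- x) \<le> p (- x)"
        using C_A[OF q] by (auto simp: A_def le_fun_def)
      then show "- p (- x) \<le> q x"
        using sublinear_minus[OF sub[OF q], of x] by simp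
    qed
    have "sublinear u"
    proof (rule sublinearI)
      fix x y
      have "u (x + y) \<le> q x + q' y" if q: "q \<in> C" "q' \<in> C" for q q'
      proof -
        \<comment> \<open>The two infima may be approached by different members of the chain; the
          smaller one lies below both, and its subadditivity suffices.\<close>
        obtain m where m: "m \<in> C" "m \<le> q" "m \<le> q'"
          using C_chain[OF q] q by blast
        have "u (x + y) \<le> m x + m y"
          using u_le[OF m(1)] sublinear_add[OF sub[OF m(1)]] order_trans by blast
        also have "\<dots> \<le> q x + q' y"
          using m by (intro add_mono) (auto simp: le_fun_def)
        finally show ?thesis .
      qed
      then show "u (x + y) \<le> u x + u y"
        unfolding u_def[of x] u_def[of y] using False by (intro le_cINF_add) auto
    next
      fix r :: real and x assume r: "0 < r"
      have "u (r *\<^sub>R x) / r \<le> q x" if "q \<in> C" for q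
        using u_le[OF that, of "r *\<^sub>R x"] sublinear_scaleR[OF sub[OF that] r] r
        by (simp add: field_simps)
      then have "u (r *\<^sub>R x) / r \<le> u x"
        unfolding u_def[of x] using False by (intro cINF_greatest) auto
      then show "u (r *\<^sub>R x) \<le> r * u x" using r by (simp add: field_simps)
    qed
    moreover have "u \<le> p"
    proof -
      obtain q where "q \<in> C" using False by blast
      then have "u \<le> q" "q \<le> p"
        using u_le C_A by (auto simp: A_def le_fun_def)
      then show ?thesis by (rule order_trans)
    qed
    ultimately show ?thesis
      using u_le by (intro bexI[of _ u]) (auto simp: A_def P_def le_fun_def)
  qed
  then obtain m where "m \<in> A" "\<forall>a\<in>A. P m a \<longrightarrow> a = m"
    using predicate_Zorn[OF po] by blast
  then show ?thesis
    using that[of m] by (auto simp: A_def P_def intro: order_trans)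
qed

text \<open>Tilting p along a fixes the value at a of every linear functional below the tilt. A
  minimal sublinear functional there is linear, since no further tilt can lower it.\<close>

theorem Hahn_Banach_sublinear:
  assumes p: "sublinear p"
  obtains l where "linear l" and "l \<le> p" and "l a = p a"
proof -
  obtain p' where p': "sublinear p'" "p' \<le> p" "\<And>y. p' y \<le> p (y + a) - p a"
    by (rule sublinear_tilt[OF p, of a]) (rule that)
  obtain l where l: "sublinear l" "l \<le> p'"
      and minimal: "\<And>q'. sublinear q' \<Longrightarrow> q' \<le> l \<Longrightarrow> q' = l"
    by (rule sublinear_minimal[OF p'(1)]) (rule that)
  have l_add: "l (x + y) = l x + l y" for x y
  proof (rule antisym[OF sublinear_add[OF l(1)]])
    \<comment> \<open>By minimality the tilt q of l along y is l itself, so its bound becomes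
      superadditivity.\<close>
    obtain q where q: "sublinear q" "q \<le> l" "\<And>x. q x \<le> l (x + y) - l y"
      by (rule sublinear_tilt[OF l(1), of y]) (rule that)
    show "l x + l y \<le> l (x + y)"
      using q(3)[of x] minimal[OF q(1,2)] by simp
  qed
  have l_minus: "l (- x) = - l x" for x
    using l_add[of x "- x"] sublinear_zero[OF l(1)] by simp
  have "l (r *\<^sub>R x) = r * l x" for r x
  proof (cases r "0 :: real" rule: linorder_cases)
    case less
    then show ?thesis
      using sublinear_scaleR[OF l(1), of "- r" x] l_minus[of "r *\<^sub>R x"] by simp
  qed (use sublinear_zero[OF l(1)] sublinear_scaleR[OF l(1)] in auto)
  then have "linear l" by (intro linearI) (auto simp: l_add)
  moreover have le: "l \<le> p" using l(2) p'(2) by (rule order_trans)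
  moreover have "l a = p a"
  proof (rule antisym)
    show "l a \<le> p a" using le by (simp add: le_fun_def)
    have "- l a \<le> p' (- a)"
      using l(2) by (simp add: le_fun_def flip: l_minus)
    \<comment> \<open>At y = -a the bound of the tilt reads
      \<open>p' (- a) \<le> p 0 - p a\<close>.\<close>
    also have "\<dots> \<le> - p a"
      using p'(3)[of "- a"] sublinear_zero[OF p] by simp
    finally show "p a \<le> l a" by simp
  qed
  ultimately show ?thesis by (rule that)
qed

section \<open>Complex Hahn-Banach theorem for the distance to a subspace\<close>

lemma infdist_csubspace_add:
  assumes J: "csubspace J"
  shows "infdist (x + y) J \<le> infdist x J + infdist y J"
proof -
  have ne: "J \<noteq> {}" using cvec.subspace_0[OF J] by blast
  have "infdist (x + y) J \<le> dist x a + dist y b" if "a \<in> J" "b \<in> J" for a b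
    using infdist_le[OF cvec.subspace_add[OF J that], of "x + y"] dist_triangle_add[of x y a b]
    by simp
  then show ?thesis
    unfolding infdist_notempty[OF ne, of x] infdist_notempty[OF ne, of y]
    using ne by (intro le_cINF_add) auto
qed

lemma infdist_csubspace_scaleC:
  assumes J: "csubspace J"
  shows "infdist (c *\<^sub>C x) J \<le> cmod c * infdist x J"
proof (cases "c = 0")
  case True
  then show ?thesis using cvec.subspace_0[OF J] by simp
next
  case False
  have ne: "J \<noteq> {}" using cvec.subspace_0[OF J] by blast
  have "infdist (c *\<^sub>C x) J / cmod c \<le> dist x a" if "a \<in> J" for a
  proof -
    have "infdist (c *\<^sub>C x) J \<le> dist (c *\<^sub>C x) (c *\<^sub>C a)"
      by (rule infdist_le[OF cvec.subspace_scale[OF J that]])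
    also have "\<dots> = cmod c * dist x a"
      by (simp add: dist_norm norm_scaleC flip: cvec.scale_right_diff_distrib)
    finally show ?thesis using False by (simp add: field_simps)
  qed
  then have "infdist (c *\<^sub>C x) J / cmod c \<le> infdist x J"
    unfolding infdist_notempty[OF ne, of x] using ne by (intro cINF_greatest) auto
  then show ?thesis using False by (simp add: field_simps)
qed

text \<open>The distance to J is a complex seminorm that vanishes on J and is at most the norm. A
  functional whose modulus it dominates therefore kills J and has norm at most 1.\<close>

theorem Hahn_Banach_distance:
  fixes J :: "'a::complex_normed_vector set"
  assumes J: "csubspace J"
  obtains f :: "'a cdual" where "f \<in> annihilator J" and "norm f \<le> 1"
    and "f a = complex_of_real (infdist a J)"
proof -
  define p where "p x = infdist x J" for x
  have p_scale: "p (c *\<^sub>C x) \<le> cmod c * p x" for c x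
    unfolding p_def by (rule infdist_csubspace_scaleC[OF J])
  have p_le: "p x \<le> norm x" for x
    using infdist_le[OF cvec.subspace_0[OF J], of x] by (simp add: p_def)
  have p_J: "p x = 0" if "x \<in> J" for x
    using that by (simp add: p_def)
  have "sublinear p"
  proof (rule sublinearI)
    show "p (x + y) \<le> p x + p y" for x y
      unfolding p_def by (rule infdist_csubspace_add[OF J])
    show "p (r *\<^sub>R x) \<le> r * p x" if "0 < r" for r x
      using p_scale[of "complex_of_real r" x] that by (simp add: scaleR_scaleC)
  qed
  then obtain l where l: "linear l" "l \<le> p" "l a = p a"
    by (rule Hahn_Banach_sublinear)
  \<comment> \<open>The complex-linear functional with real part l: h(x) = l(x) - i l(ix).\<close>
  define h where "h x = Complex (l x) (- l (\<i> *\<^sub>C x))" for x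
  have h_add: "h (x + y) = h x + h y" for x y
    by (simp add: h_def scaleC_add_right linear_add[OF l(1)] complex_eq_iff)
  have h_scale: "h (c *\<^sub>C x) = c * h x" for c x
  proof -
    have l_scale: "l (c *\<^sub>C x) = Re c * l x + Im c * l (\<i> *\<^sub>C x)" for c x
    proof -
      have "c *\<^sub>C x = Re c *\<^sub>R x + Im c *\<^sub>R \<i> *\<^sub>C x"
        by (simp add: scaleR_scaleC scaleC_scaleC mult.commute
            flip: scaleC_add_left complex_eq)
      then show ?thesis
        by (simp add: linear_add[OF l(1)] linear_scale[OF l(1)])
    qed
    show ?thesis
      by (simp add: h_def complex_eq_iff scaleC_scaleC l_scale[of c] l_scale[of "\<i> * c"])
  qed
  have h_le: "cmod (h x) \<le> p x" for x
  proof -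
    \<comment> \<open>Multiplication by c turns \<open>h x\<close> into its modulus, which is then a
      value of Re h = l and hence bounded by p. For \<open>h x = 0\<close> this c is 0.\<close>
    define c where "c = cnj (sgn (h x))"
    have "c * h x = complex_of_real (cmod (h x))"
      by (cases "h x = 0")
        (auto simp: c_def sgn_eq complex_norm_square[symmetric] field_simps power2_eq_square
          simp flip: of_real_mult)
    then have "cmod (h x) = Re (h (c *\<^sub>C x))"
      by (simp add: h_scale)
    also have "\<dots> \<le> p (c *\<^sub>C x)"
      using l(2) by (simp add: h_def le_fun_def)
    also have "\<dots> \<le> cmod c * p x" by (rule p_scale)
    also have "\<dots> \<le> 1 * p x"
      by (intro mult_right_mono) (auto simp: c_def norm_sgn p_def infdist_nonneg)
    finally show ?thesis by simp
  qed
  define f where "f = cblinfun_of_fun h"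
  have f: "cblinfun_apply f = h"
    unfolding f_def
    by (rule cblinfun_apply_of_fun[where K = 1])
      (auto simp: h_add h_scale scaleC_complex_def intro: order_trans[OF h_le p_le])
  show ?thesis
  proof (rule that)
    show "f \<in> annihilator J"
      unfolding annihilator_def
    proof (intro CollectI ballI)
      show "f x = 0" if "x \<in> J" for x
        using h_le[of x] p_J[OF that] by (simp add: f)
    qed
    show "norm f \<le> 1"
      by (rule norm_cblinfun_bound) (auto simp: f intro: order_trans[OF h_le p_le])
    \<comment> \<open>The modulus of \<open>h a\<close> is at most \<open>p a\<close>, which is
      already its real part, so the imaginary part vanishes.\<close>
    have "(l a)\<^sup>2 + (l (\<i> *\<^sub>C a))\<^sup>2 \<le> (l a)\<^sup>2"
      using power_mono[OF h_le[of a], of 2] by (simp add: h_def cmod_power2 l(3))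
    then have "h a = complex_of_real (p a)"
      by (simp add: h_def complex_eq_iff l(3))
    then show "f a = complex_of_real (infdist a J)" by (simp add: f p_def)
  qed
qed


section \<open>L-projections and weak* closed convex hulls\<close>

lemma cblinfun_add_right: "cblinfun_apply T (x + y) = cblinfun_apply T x + cblinfun_apply T y"
  by (rule linear_add[OF bounded_linear.linear[OF bounded_linear_cblinfun_apply]])

lemma cblinfun_zero_right: "cblinfun_apply T 0 = 0"
  by (rule linear_0[OF bounded_linear.linear[OF bounded_linear_cblinfun_apply]])

lemma cblinfun_zero_left: "cblinfun_apply 0 x = 0"
  by transfer simp

lemma cblinfun_sum_left: "cblinfun_apply (\<Sum>i\<in>I. T i) x = (\<Sum>i\<in>I. cblinfun_apply (T i) x)"
  by (induction I rule: infinite_finite_induct) (simp_all add: cblinfun_add_left cblinfun_zero_left)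

text \<open>Families of pieces \<open>M (R, _)\<close> of a functional, kept as plain functions on
  pairs so that compactness is that of a product of discs. The first bound concerns every R and
  confines the family to that product. The norm of a piece is bounded by its weight
  \<open>Re (M (R, a))\<close>; the weights sum to 1, so the norms sum to at most 1. Every condition
  is closed and survives convex combinations.\<close>

definition splittings ::
    "'e::complex_normed_vector set \<Rightarrow> real \<Rightarrow> 'e \<Rightarrow> ('e \<times> 'e \<Rightarrow> complex) set"
  where "splittings \<R> d a = {M. (\<forall>R x. cmod (M (R, x)) \<le> norm x) \<and>
    (\<forall>R\<in>\<R>. (\<forall>x y. M (R, x + y) = M (R, x) + M (R, y)) \<and>
      (\<forall>c x. M (R, c *\<^sub>C x) = c * M (R, x)) \<and>
      (\<forall>x. cmod (M (R, x)) \<le> Re (M (R, a)) * norm x) \<and>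
      d * Re (M (R, a)) \<le> Re (M (R, R))) \<and>
    (\<Sum>R\<in>\<R>. Re (M (R, a))) = 1}"

text \<open>The set is closed in the product of the discs of radius \<open>norm x\<close>, which is
  compact by Tychonoff's theorem.\<close>

lemma compact_splittings: "compact (splittings \<R> d a)"
proof -
  let ?B = "PiE UNIV (\<lambda>(R, x). cball 0 (norm x)) :: ('a \<times> 'a \<Rightarrow> complex) set"
  have "compactin (product_topology (\<lambda>_. euclidean) UNIV) ?B"
    by (subst compactin_PiE) (auto simp: compactin_euclidean_iff)
  then have "compact ?B"
    by (simp add: euclidean_product_topology compactin_euclidean_iff)
  moreover have coord: "continuous_on UNIV (\<lambda>M :: 'a \<times> 'a \<Rightarrow> complex. M i)" for i
    by simp
  have "closed (splittings \<R> d a)"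
    unfolding splittings_def Ball_def
    by (intro closed_Collect_conj closed_Collect_all closed_Collect_imp open_Collect_const
        closed_Collect_eq closed_Collect_le continuous_intros coord)
  ultimately have "compact (?B \<inter> splittings \<R> d a)"
    by (rule compact_Int_closed)
  moreover have "splittings \<R> d a \<subseteq> ?B"
    by (auto simp: splittings_def)
  ultimately show ?thesis by (simp add: Int_absorb1)
qed

lemma convex_combination_splittings:
  assumes M: "M \<in> splittings \<R> d a" and N: "N \<in> splittings \<R> d a"
    and uv: "0 \<le> u" "0 \<le> v" "u + v = 1"
  shows "(\<lambda>p. complex_of_real u * M p + complex_of_real v * N p) \<in> splittings \<R> d a"
proof -
  have bound: "cmod (complex_of_real u * z + complex_of_real v * w) \<le> u * r + v * s"
    if "cmod z \<le> r" "cmod w \<le> s" for z w r s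
  proof -
    have "cmod (complex_of_real u * z + complex_of_real v * w) \<le> u * cmod z + v * cmod w"
      using uv norm_triangle_ineq[of "complex_of_real u * z" "complex_of_real v * w"]
      by (simp add: norm_mult)
    also have "\<dots> \<le> u * r + v * s"
      using that uv by (intro add_mono mult_left_mono) auto
    finally show ?thesis .
  qed
  have "cmod (complex_of_real u * M (R, x) + complex_of_real v * N (R, x)) \<le> norm x" for R x
  proof -
    have "u * norm x + v * norm x = norm x"
      using uv(3) by (simp flip: distrib_right)
    then show ?thesis
      using bound[of "M (R, x)" "norm x" "N (R, x)" "norm x"] M N by (simp add: splittings_def)
  qed
  moreover have "cmod (complex_of_real u * M (R, x) + complex_of_real v * N (R, x))
      \<le> (u * Re (M (R, a)) + v * Re (N (R, a))) * norm x" if "R \<in> \<R>" for R x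
    using bound[of "M (R, x)" "Re (M (R, a)) * norm x" "N (R, x)" "Re (N (R, a)) * norm x"] M N that
    by (simp add: splittings_def algebra_simps)
  moreover have "d * (u * Re (M (R, a)) + v * Re (N (R, a)))
      \<le> u * Re (M (R, R)) + v * Re (N (R, R))" if "R \<in> \<R>" for R
  proof -
    have "u * (d * Re (M (R, a))) + v * (d * Re (N (R, a))) \<le> u * Re (M (R, R)) + v * Re (N (R, R))"
      using M N uv that by (intro add_mono mult_left_mono) (auto simp: splittings_def)
    then show ?thesis by (simp add: algebra_simps)
  qed
  moreover have "(\<Sum>R\<in>\<R>. u * Re (M (R, a)) + v * Re (N (R, a))) = 1"
    using M N uv by (simp add: splittings_def sum.distrib flip: sum_distrib_left)
  ultimately show ?thesis
    using M N by (auto simp: splittings_def algebra_simps)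
qed

text \<open>A convex combination of functionals \<open>\<phi>\<close> is split by grouping its terms according to
  an element \<open>R\<close> with \<open>d \<le> Re (\<phi> R)\<close>; compactness carries the splitting over to weak* limits.\<close>

lemma closure_convex_hull_splittings:
  fixes S :: "'e::complex_normed_vector cdual set"
  assumes fin: "finite \<R>"
    and norm: "\<And>\<phi>. \<phi> \<in> S \<Longrightarrow> norm \<phi> \<le> 1"
    and one: "\<And>\<phi>. \<phi> \<in> S \<Longrightarrow> \<phi> a = 1"
    and big: "\<And>\<phi>. \<phi> \<in> S \<Longrightarrow> \<exists>R\<in>\<R>. d \<le> Re (\<phi> R)"
    and \<Lambda>: "\<Lambda> \<in> weak_star_topology closure_of (convex hull S)"
  obtains M where "M \<in> splittings \<R> d a" and "\<And>x. \<Lambda> x = (\<Sum>R\<in>\<R>. M (R, x))"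
proof -
  define \<Sigma> where "\<Sigma> M x = (\<Sum>R\<in>\<R>. M (R, x))" for M :: "'e \<times> 'e \<Rightarrow> complex" and x
  \<comment> \<open>The functionals that are sums of a splitting. This set contains S and is convex
    and weak* closed, so it contains the closed hull.\<close>
  define C where "C = cblinfun_apply -` (\<Sigma> ` splittings \<R> d a)"
  have "S \<subseteq> C"
  proof
    fix \<phi> assume \<phi>: "\<phi> \<in> S"
    obtain R\<^sub>0 where R\<^sub>0: "R\<^sub>0 \<in> \<R>" "d \<le> Re (\<phi> R\<^sub>0)"
      using big[OF \<phi>] by blast
    have le: "cmod (\<phi> x) \<le> norm x" for x
      using norm_cblinfun[of \<phi> x] mult_right_mono[OF norm[OF \<phi>], of "norm x"] by simp
    \<comment> \<open>The whole functional goes to \<open>R\<^sub>0\<close>, whose weight is then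
      \<open>Re (\<phi> a) = 1\<close>; all other pieces are 0.\<close>
    define M where "M = (\<lambda>(R, x). if R = R\<^sub>0 then \<phi> x else 0)"
    have "M \<in> splittings \<R> d a"
      using le R\<^sub>0 one[OF \<phi>] fin
      by (auto simp: splittings_def M_def cblinfun_add_right cblinfun_scaleC_right
          scaleC_complex_def if_distrib[of Re] cong: if_cong)
    moreover have "cblinfun_apply \<phi> = \<Sigma> M"
      using R\<^sub>0 fin by (auto simp: \<Sigma>_def M_def)
    ultimately show "\<phi> \<in> C" by (auto simp: C_def)
  qed
  moreover have "convex C"
  proof (rule convexI)
    fix \<phi> \<psi> and u v :: real
    assume "\<phi> \<in> C" "\<psi> \<in> C" and uv: "0 \<le> u" "0 \<le> v" "u + v = 1"
    then obtain M N where M: "M \<in> splittings \<R> d a" "cblinfun_apply \<phi> = \<Sigma> M"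
      and N: "N \<in> splittings \<R> d a" "cblinfun_apply \<psi> = \<Sigma> N"
      by (auto simp: C_def)
    have "cblinfun_apply (u *\<^sub>R \<phi> + v *\<^sub>R \<psi>)
        = \<Sigma> (\<lambda>p. complex_of_real u * M p + complex_of_real v * N p)"
      by (rule ext) (simp add: cblinfun_add_left cblinfun_scaleR_left M(2) N(2) \<Sigma>_def sum.distrib
          scaleR_conv_of_real flip: sum_distrib_left)
    then show "u *\<^sub>R \<phi> + v *\<^sub>R \<psi> \<in> C"
      using convex_combination_splittings[OF M(1) N(1) uv] by (auto simp: C_def)
  qed
  ultimately have "convex hull S \<subseteq> C" by (rule hull_minimal)
  moreover have "closedin weak_star_topology C"
  proof -
    have coord: "continuous_on UNIV (\<lambda>M :: 'e \<times> 'e \<Rightarrow> complex. M i)" for i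
      by simp
    have "continuous_on UNIV \<Sigma>"
      unfolding \<Sigma>_def
      by (intro continuous_on_coordinatewise_then_product continuous_intros coord)
    \<comment> \<open>Compactness makes the set of sums closed in the product, and the weak*
      topology is pulled back from there.\<close>
    then have "compact (\<Sigma> ` splittings \<R> d a)"
      by (intro compact_continuous_image compact_splittings) (rule continuous_on_subset, auto)
    moreover have "Hausdorff_space (euclidean :: ('e \<Rightarrow> complex) topology)"
      by (simp add: Hausdorff_space_product_topology flip: euclidean_product_topology)
    ultimately have "closed (\<Sigma> ` splittings \<R> d a)"
      using compactin_imp_closedin[of euclidean "\<Sigma> ` splittings \<R> d a"]
      by (simp add: compactin_euclidean_iff)
    then have "openin weak_star_topology (cblinfun_apply -` (- (\<Sigma> ` splittings \<R> d a)))"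
      unfolding weak_star_topology_def openin_pullback_topology
      by (intro exI[of _ "- (\<Sigma> ` splittings \<R> d a)"]) (auto simp: open_Compl)
    moreover have "topspace weak_star_topology = (UNIV :: 'e cdual set)"
      by (simp add: weak_star_topology_def topspace_pullback_topology)
    ultimately show ?thesis
      by (simp add: closedin_def C_def vimage_Diff Compl_eq_Diff_UNIV)
  qed
  ultimately have "\<Lambda> \<in> C"
    using \<Lambda> closure_of_minimal by blast
  then show ?thesis
    using that by (auto simp: C_def \<Sigma>_def fun_eq_iff)
qed

lemma splitting_functional:
  assumes M: "M \<in> splittings \<R> d a" and R: "R \<in> \<R>"
  obtains f :: "'e::complex_normed_vector cdual"
    where "cblinfun_apply f = (\<lambda>x. M (R, x))" and "norm f \<le> Re (M (R, a))"
proof -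
  have le: "cmod (M (R, x)) \<le> Re (M (R, a)) * norm x" for x
    using M R by (simp add: splittings_def)
  have f: "cblinfun_apply (cblinfun_of_fun (\<lambda>x. M (R, x))) = (\<lambda>x. M (R, x))"
    using M R le
    by (intro cblinfun_apply_of_fun[where K = "Re (M (R, a))"])
      (auto simp: splittings_def scaleC_complex_def mult.commute)
  \<comment> \<open>The norm bound needs a nonnegative constant; the estimate at x = a supplies the
    sign.\<close>
  have nonneg: "0 \<le> Re (M (R, a))"
  proof (cases "a = 0")
    case True
    then have "M (R, a) = 0" using M R le[of a] by simp
    then show ?thesis by simp
  next
    case False
    have "0 \<le> Re (M (R, a)) * norm a"
      using norm_ge_zero le[of a] by (rule order_trans)
    then show ?thesis using False by (simp add: zero_le_mult_iff)
  qed
  have "norm (cblinfun_of_fun (\<lambda>x. M (R, x))) \<le> Re (M (R, a))"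
    by (rule norm_cblinfun_bound[OF nonneg]) (simp add: f le)
  with f show ?thesis by (rule that)
qed

text \<open>The annihilator of an M-ideal meets the dual unit ball in a face.\<close>

lemma M_ideal_annihilator_face:
  fixes N :: "'i \<Rightarrow> 'e::cbanach cdual"
  assumes "M_ideal J"
    and fin: "finite I"
    and ann: "(\<Sum>i\<in>I. N i) \<in> annihilator J"
    and norm: "(\<Sum>i\<in>I. norm (N i)) \<le> norm (\<Sum>i\<in>I. N i)"
    and i: "i \<in> I"
  shows "N i \<in> annihilator J"
proof -
  obtain P :: "'e cdual \<Rightarrow> 'e cdual" where lin: "clinear P"
    and ker: "{f. P f = 0} = annihilator J"
    and P: "\<And>f. norm f = norm (P f) + norm (f - P f)"
    using assms(1) unfolding M_ideal_def by blast
  have P_sum: "P (\<Sum>i\<in>I. N i) = (\<Sum>i\<in>I. P (N i))"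
    by (rule module_hom.sum[OF Vector_Spaces.linear.axioms(3)[OF lin]])
  \<comment> \<open>P kills the sum, so only the complementary parts \<open>N i - P (N i)\<close>
    remain. The triangle inequality and the additivity of the norm then leave no norm for the parts
    \<open>P (N i)\<close>.\<close>
  have "(\<Sum>i\<in>I. N i) = (\<Sum>i\<in>I. N i - P (N i))"
  proof -
    have "P (\<Sum>i\<in>I. N i) = 0" using ann ker by blast
    then show ?thesis by (simp add: P_sum sum_subtractf)
  qed
  then have "norm (\<Sum>i\<in>I. N i) \<le> (\<Sum>i\<in>I. norm (N i - P (N i)))"
    by (metis norm_sum)
  also have "\<dots> = (\<Sum>i\<in>I. norm (N i)) - (\<Sum>i\<in>I. norm (P (N i)))"
    unfolding sum_subtractf[symmetric] by (rule sum.cong) (auto simp: P[of "N _"])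
  finally have "(\<Sum>i\<in>I. norm (P (N i))) \<le> 0"
    using norm by simp
  then have "norm (P (N i)) = 0"
    using sum_nonneg_eq_0_iff[OF fin, of "\<lambda>i. norm (P (N i))"] i
    by (metis norm_ge_zero order_antisym sum_nonneg)
  then show ?thesis using ker by auto
qed

text \<open>If \<Lambda> annihilated J, so would its pieces, by the face property. Each piece would
  vanish at its own R in J, which forces its weight to be at most 0, while the weights sum to
  1.\<close>

lemma M_ideal_annihilator_closure_convex_hull:
  fixes S :: "'e::cbanach cdual set"
  assumes J: "M_ideal J"
    and fin: "finite \<R>" and \<R>_J: "\<R> \<subseteq> J"
    and d: "0 < d"
    and a: "norm a \<le> 1"
    and norm: "\<And>\<phi>. \<phi> \<in> S \<Longrightarrow> norm \<phi> \<le> 1"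
    and one: "\<And>\<phi>. \<phi> \<in> S \<Longrightarrow> \<phi> a = 1"
    and big: "\<And>\<phi>. \<phi> \<in> S \<Longrightarrow> \<exists>R\<in>\<R>. d \<le> Re (\<phi> R)"
    and \<Lambda>: "\<Lambda> \<in> weak_star_topology closure_of (convex hull S)"
  shows "\<Lambda> \<notin> annihilator J"
proof
  assume ann: "\<Lambda> \<in> annihilator J"
  obtain M where M: "M \<in> splittings \<R> d a" and M_sum: "\<And>x. \<Lambda> x = (\<Sum>R\<in>\<R>. M (R, x))"
    by (rule closure_convex_hull_splittings[OF fin norm one big \<Lambda>], assumption+, rule that)
  have "\<forall>R\<in>\<R>. \<exists>f :: 'e cdual. cblinfun_apply f = (\<lambda>x. M (R, x)) \<and> norm f \<le> Re (M (R, a))"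
    using splitting_functional[OF M] by metis
  then obtain N :: "'e \<Rightarrow> 'e cdual" where N: "\<And>R. R \<in> \<R> \<Longrightarrow> cblinfun_apply (N R) = (\<lambda>x. M (R, x))"
    and norm_N: "\<And>R. R \<in> \<R> \<Longrightarrow> norm (N R) \<le> Re (M (R, a))"
    by metis
  have \<Lambda>_sum: "\<Lambda> = (\<Sum>R\<in>\<R>. N R)"
    by (rule cblinfun_eqI) (simp add: cblinfun_sum_left M_sum N)
  have total: "(\<Sum>R\<in>\<R>. Re (M (R, a))) = 1"
    using M by (simp add: splittings_def)
  have "(\<Sum>R\<in>\<R>. norm (N R)) \<le> 1"
    using sum_mono[of \<R> "\<lambda>R. norm (N R)", OF norm_N] total by simp
  \<comment> \<open>The face property requires that the norms of the pieces sum to at most the norm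
    of \<Lambda>; evaluation at a shows that the latter is at least 1.\<close>
  also have "1 \<le> norm \<Lambda>"
  proof -
    have "1 = Re (\<Lambda> a)" by (simp add: M_sum total)
    also have "\<dots> \<le> norm \<Lambda> * norm a"
      using complex_Re_le_cmod norm_cblinfun by (rule order_trans)
    also have "\<dots> \<le> norm \<Lambda>"
      using a mult_left_mono[OF a norm_ge_zero, of \<Lambda>] by simp
    finally show ?thesis .
  qed
  finally have "N R \<in> annihilator J" if "R \<in> \<R>" for R
    using M_ideal_annihilator_face[OF J fin _ _ that] ann by (simp add: \<Lambda>_sum)
  then have "M (R, R) = 0" if "R \<in> \<R>" for R
    using that \<R>_J fun_cong[OF N[OF that], of R] by (auto simp: annihilator_def)
  then have "d * Re (M (R, a)) \<le> 0" if "R \<in> \<R>" for R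
    using M that by (auto simp: splittings_def)
  then have "(\<Sum>R\<in>\<R>. Re (M (R, a))) \<le> 0"
    using d by (intro sum_nonpos) (auto simp: mult_le_0_iff)
  then show False using total by simp
qed

section \<open>Rank one operators\<close>

lemma not_weak_star_accumulation:
  fixes E :: "'a::complex_normed_vector cdual set"
  assumes "0 \<notin> weak_star_topology derived_set_of E"
  obtains X e where "finite X" and "0 < e" and "\<And>f. f \<in> E \<Longrightarrow> f \<noteq> 0 \<Longrightarrow> \<exists>x\<in>X. e \<le> cmod (f x)"
proof -
  have "topspace weak_star_topology = (UNIV :: 'a cdual set)"
    by (simp add: weak_star_topology_def topspace_pullback_topology)
  then obtain U where U: "0 \<in> U" "openin weak_star_topology U" "\<And>f. f \<in> E \<Longrightarrow> f \<noteq> 0 \<Longrightarrow> f \<notin> U"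
    using assms by (auto simp: in_derived_set_of)
  then obtain V where V: "open V" "U = cblinfun_apply -` V"
    by (auto simp: weak_star_topology_def openin_pullback_topology)
  have "cblinfun_apply 0 \<in> V" using U(1) V(2) by auto
  \<comment> \<open>A basic neighbourhood restricts only finitely many coordinates; these become the
    test points X.\<close>
  then obtain W where W: "cblinfun_apply 0 \<in> PiE UNIV W" "\<And>x. open (W x)"
    "finite {x. W x \<noteq> UNIV}" "PiE UNIV W \<subseteq> V"
    using product_topology_open_contains_basis[of "\<lambda>_. euclidean" UNIV V "cblinfun_apply 0"] V(1)
    by (auto simp: open_fun_def)
  define X where "X = {x. W x \<noteq> UNIV}"
  have "\<exists>e>0. ball 0 e \<subseteq> W x" for x
    using W(1) W(2)[of x] by (auto simp: PiE_iff cblinfun_zero_left open_contains_ball)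
  then obtain r where r: "\<And>x. 0 < r x" "\<And>x. ball 0 (r x) \<subseteq> W x"
    by metis
  \<comment> \<open>The 1 makes the minimum meaningful when X is empty.\<close>
  define e where "e = Min (insert 1 (r ` X))"
  have fin: "finite X" using W(3) by (simp add: X_def)
  have e: "0 < e" "\<And>x. x \<in> X \<Longrightarrow> e \<le> r x"
    using fin r(1) by (auto simp: e_def)
  have "\<exists>x\<in>X. e \<le> cmod (f x)" if f: "f \<in> E" "f \<noteq> 0" for f
  proof (rule ccontr)
    assume neg: "\<not> ?thesis"
    have "f x \<in> W x" for x
    proof (cases "x \<in> X")
      case True
      then have "f x \<in> ball 0 (r x)" using neg e(2)[of x] by force
      then show ?thesis using r(2) by blast
    qed (simp add: X_def)
    then have "cblinfun_apply f \<in> V" using W(4) by auto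
    then show False using U(3)[OF f] V(2) by simp
  qed
  with fin e(1) show ?thesis by (rule that)
qed

section \<open>Tensor functionals on rank one operators\<close>

definition rank_one ::
    "'a::complex_normed_vector cdual \<Rightarrow> 'b::complex_normed_vector \<Rightarrow> 'a \<Rightarrow>\<^sub>C\<^sub>L 'b"
  where "rank_one f y = cblinfun_of_fun (\<lambda>x. f x *\<^sub>C y)"

lemma cblinfun_apply_rank_one: "cblinfun_apply (rank_one f y) x = f x *\<^sub>C y"
proof -
  have "norm (f x *\<^sub>C y) \<le> norm x * (norm f * norm y)" for x
    using mult_right_mono[OF norm_cblinfun[of f x] norm_ge_zero[of y]]
    by (simp add: norm_scaleC algebra_simps)
  then have "cblinfun_apply (rank_one f y) = (\<lambda>x. f x *\<^sub>C y)"
    unfolding rank_one_def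
    by (intro cblinfun_apply_of_fun)
      (auto simp: cblinfun_add_right cblinfun_scaleC_right scaleC_add_left scaleC_scaleC scaleC_complex_def)
  then show ?thesis by simp
qed

lemma rank_one_finite_rank: "rank_one f y \<in> finite_rank_operators"
proof -
  have "range (cblinfun_apply (rank_one f y)) \<subseteq> cspan {y}"
    by (auto simp: cblinfun_apply_rank_one intro: cvec.span_scale cvec.span_base)
  then show ?thesis by (force simp: finite_rank_operators_def)
qed

text \<open>The adjoint of \<open>rank_one f y\<close> takes g to the multiple \<open>g y\<close> of
  f. Lower bounds for the two factors can thus be multiplied.\<close>

lemma tensor_functional_rank_one:
  fixes F :: "'a::complex_normed_vector cdual cdual" and g :: "'b::complex_normed_vector cdual"
  shows "cblinfun_apply (F \<otimes>\<^sub>C g) (rank_one f y) = cblinfun_apply F f * cblinfun_apply g y"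
proof -
  have "g o\<^sub>C rank_one f y = g y *\<^sub>C f"
    by (rule cblinfun_eqI)
      (simp add: cblinfun_apply_compose cblinfun_apply_rank_one cblinfun_scaleC_left
        cblinfun_scaleC_right scaleC_complex_def mult.commute)
  then show ?thesis
    by (simp add: cblinfun_apply_tensor_functional cblinfun_apply_cadjoint cblinfun_scaleC_right
        scaleC_complex_def mult.commute)
qed

lemma norm_tensor_functional:
  fixes F :: "'a::complex_normed_vector cdual cdual" and g :: "'b::complex_normed_vector cdual"
  shows "norm (F \<otimes>\<^sub>C g) \<le> norm F * norm g"
proof (rule norm_cblinfun_bound)
  fix T :: "'a \<Rightarrow>\<^sub>C\<^sub>L 'b"
  have "cmod ((F \<otimes>\<^sub>C g) T) \<le> norm F * norm (g o\<^sub>C T)"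
    unfolding cblinfun_apply_tensor_functional cblinfun_apply_cadjoint by (rule norm_cblinfun)
  also have "\<dots> \<le> norm F * (norm g * norm T)"
    by (intro mult_left_mono norm_cblinfun_compose norm_ge_zero)
  finally show "cmod ((F \<otimes>\<^sub>C g) T) \<le> norm F * norm g * norm T" by (simp add: mult.assoc)
qed simp

text \<open>The modulus is at most |Re z| + |Im z|, so one of the two is at least half of it.
  Finitely many rotations suffice at the price of the factor 1/2.\<close>

lemma exists_quarter_turn:
  "\<exists>c\<in>{1, -1, \<i>, -\<i>}. cmod z / 2 \<le> Re (c * z)"
proof -
  have "cmod z \<le> \<bar>Re z\<bar> + \<bar>Im z\<bar>" by (rule cmod_le)
  then have "cmod z / 2 \<le> Re z \<or> cmod z / 2 \<le> - Re z \<or> cmod z / 2 \<le> - Im z \<or> cmod z / 2 \<le> Im z"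
    by linarith
  then show ?thesis by auto
qed

section \<open>The distance to the M-ideal\<close>

theorem proposition9:
  fixes A :: "'a::cbanach \<Rightarrow>\<^sub>C\<^sub>L 'b::cbanach"
    and J :: "('a \<Rightarrow>\<^sub>C\<^sub>L 'b) set"
  assumes "J \<subseteq> compact_operators"
    and "M_ideal J"
    and "finite_rank_operators \<subseteq> J"
    and "0 \<notin> weak_star_topology derived_set_of (extreme_ball :: 'a cdual cdual set)"
    and "0 \<notin> weak_star_topology derived_set_of (extreme_ball :: 'b cdual set)"
    and "norm A = 1"
    and "norming_functionals A = weak_star_topology closure_of
           (convex hull {F \<otimes>\<^sub>C g | F g.
              F (cadjoint A g) = 1 \<and> F \<in> extreme_ball \<and> g \<in> extreme_ball})"
  shows "infdist A J < 1"
proof (rule ccontr)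
  assume "\<not> infdist A J < 1"
  have J: "csubspace J" using assms(2) by (simp add: M_ideal_def)
  have "infdist A J \<le> 1"
    using infdist_le[OF cvec.subspace_0[OF J], of A] assms(6) by simp
  with \<open>\<not> infdist A J < 1\<close> have dist: "infdist A J = 1" by simp
  obtain \<Lambda> where \<Lambda>: "\<Lambda> \<in> annihilator J" "norm \<Lambda> \<le> 1" "\<Lambda> A = 1"
    using Hahn_Banach_distance[OF J, of A] dist by auto
  have "1 \<le> norm \<Lambda>"
    using norm_cblinfun[of \<Lambda> A] \<Lambda>(3) assms(6) by simp
  with \<Lambda> have mem: "\<Lambda> \<in> norming_functionals A"
    by (simp add: norming_functionals_def assms(6))
  define S where "S = {F \<otimes>\<^sub>C g | F g. F (cadjoint A g) = 1 \<and>
    F \<in> (extreme_ball :: 'a cdual cdual set) \<and> g \<in> (extreme_ball :: 'b cdual set)}"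
  \<comment> \<open>Test vectors for F, and below for g: a nonzero extreme point has modulus at
    least r, respectively s, on one of them.\<close>
  obtain X :: "'a cdual set" and r where X: "finite X" "0 < r"
    and F_big: "\<And>F :: 'a cdual cdual. F \<in> extreme_ball \<Longrightarrow> F \<noteq> 0 \<Longrightarrow> \<exists>f\<in>X. r \<le> cmod (cblinfun_apply F f)"
    using not_weak_star_accumulation[OF assms(4)] by blast
  obtain Y :: "'b set" and s where Y: "finite Y" "0 < s"
    and g_big: "\<And>g :: 'b cdual. g \<in> extreme_ball \<Longrightarrow> g \<noteq> 0 \<Longrightarrow> \<exists>y\<in>Y. s \<le> cmod (cblinfun_apply g y)"
    using not_weak_star_accumulation[OF assms(5)] by blast
  \<comment> \<open>Finitely many multiples of rank one operators; the factors c rotate the value of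
    a tensor functional towards the positive real axis.\<close>
  define \<R> where "\<R> = (\<lambda>(c, f, y). c *\<^sub>C rank_one f y) ` ({1, -1, \<i>, -\<i>} \<times> X \<times> Y)"
  have norm_le: "norm x \<le> 1" if "x \<in> extreme_ball" for x :: "'c::complex_normed_vector"
    using that by (simp add: extreme_ball_def extreme_point_of_def)
  have "\<Lambda> \<notin> annihilator J"
  proof (rule M_ideal_annihilator_closure_convex_hull[OF assms(2)])
    show "finite \<R>" using X(1) Y(1) by (simp add: \<R>_def)
    show "\<R> \<subseteq> J"
      using assms(3) rank_one_finite_rank by (auto simp: \<R>_def intro!: cvec.subspace_scale[OF J])
    \<comment> \<open>The lower bounds r and s multiply; the half is lost in passing from the
      modulus to the real part.\<close>
    show "0 < r * s / 2" using X(2) Y(2) by simp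
    show "norm A \<le> 1" using assms(6) by simp
    show "\<Lambda> \<in> weak_star_topology closure_of (convex hull S)"
      using mem assms(7) by (simp add: S_def)
  next
    fix \<phi> assume "\<phi> \<in> S"
    then obtain F g where \<phi>: "\<phi> = F \<otimes>\<^sub>C g" and Fg: "F (cadjoint A g) = 1"
      and F: "F \<in> extreme_ball" and g: "g \<in> extreme_ball"
      by (auto simp: S_def)
    have "norm F * norm g \<le> 1 * 1"
      by (intro mult_mono norm_le F g) auto
    then show "norm \<phi> \<le> 1"
      using norm_tensor_functional[of F g] by (simp add: \<phi>)
    show "\<phi> A = 1" by (simp add: \<phi> cblinfun_apply_tensor_functional Fg)
    \<comment> \<open>The value 1 at A keeps F and g away from 0, the one point that the test
      vectors may miss.\<close>
    have "F \<noteq> 0" using Fg by (auto simp: cblinfun_zero_left)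
    then obtain f where f: "f \<in> X" "r \<le> cmod (cblinfun_apply F f)" using F_big[OF F] by blast
    have "g \<noteq> 0" using Fg by (auto simp: cblinfun_zero_right)
    then obtain y where y: "y \<in> Y" "s \<le> cmod (cblinfun_apply g y)" using g_big[OF g] by blast
    define z where "z = F f * g y"
    have "r * s \<le> cmod z"
      unfolding z_def norm_mult using f(2) y(2) X(2) Y(2) by (intro mult_mono) auto
    moreover obtain c where c: "c \<in> {1, -1, \<i>, -\<i>}" "cmod z / 2 \<le> Re (c * z)"
      using exists_quarter_turn by blast
    ultimately have "r * s / 2 \<le> Re (\<phi> (c *\<^sub>C rank_one f y))"
      by (simp add: \<phi> cblinfun_scaleC_right scaleC_complex_def tensor_functional_rank_one flip: z_def)
    moreover have "c *\<^sub>C rank_one f y \<in> \<R>"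
      using c(1) f(1) y(1) unfolding \<R>_def by (intro image_eqI[of _ _ "(c, f, y)"]) auto
    ultimately show "\<exists>R\<in>\<R>. r * s / 2 \<le> Re (\<phi> R)" by blast
  qed
  with \<Lambda>(1) show False by contradiction
qed

end
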